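(* Let $q\ge4$ be even. The map $$\pi\colon I_{R_q}\setminus\partial\mathcal{M}(f_q^\star)\to F_{\mathbb{A}}^{\mathbb{N}}\setminus\big\{\underline\xi\in F_{\mathbb{A}}^{\mathbb{N}}:\ \exists\,n\in\mathbb{Z}_{\ge0}:\ \tau^n(\underline\xi)=\pm\underline{r}_q\big\},$$ given by $\pi(x)=\underline\xi=(\xi_i)_{i\in\mathbb{N}}$ if $(f_q^\star)^{i-1}(x)\in J^\star_{\xi_i}$ for all $i\in\mathbb{N}$, is bijective, and $\pi\circ f_q^\star=\tau\circ\pi$. Its inverse can be defined on the entire set $F_{\mathbb{A}}^{\mathbb{N}}$, as the map $\pi^{-1}\colon F_{\mathbb{A}}^{\mathbb{N}}\to I_{R_q}$ given by $\pi^{-1}(\underline\xi)=x$, with $x$ the unique point of $I_{R_q}$ with $x\in J^\star_{\xi_1}\cap\bigcap_{l=1}^\infty(f^\star_{\xi_l}\circ\cdots\circ f^\star_{\xi_1})^{-1}J^\star_{\xi_{l+1}}$.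
   Context: Let $q\ge4$ be even, $\lambda_q=2\cos(\pi/q)$, $h_q=\kappa_q=\frac{q-2}{2}$, $R_q=1$, $r_q=1-\lambda_q$, and $I_{R_q}=[-R_q,R_q]$. For $x\ge0$ let $\langle x\rangle_q^\star$ be the integer $n$ with $n\lambda_q+r_q\le x<n\lambda_q+R_q$, and for $x<0$ put $\langle x\rangle_q^\star=-\langle-x\rangle_q^\star$. The map $f_q^\star\colon I_{R_q}\to I_{R_q}$ is $f_q^\star(y)=-\frac1y-\langle-\frac1y\rangle_q^\star\,\lambda_q$ for $y\ne0$, $f_q^\star(0)=0$. For $m\ge1$ let $J_m^\star=\big[\frac{-1}{r_q+m\lambda_q},\frac{-1}{r_q+(m+1)\lambda_q}\big]$ and $J_{-m}^\star=-J_m^\star$. Put $\psi_i=(f_q^\star)^i(-R_q)$ for $0\le i\le\kappa_q$; then $-R_q=\psi_0<\psi_1<\dots<\psi_{\kappa_q}=\frac{-1}{r_q+2\lambda_q}$. For $1\le i\le\kappa_q$ let $J^\star_{1_i}=J^\star_{+1_i}=[\psi_{i-1},\psi_i]$ and $J^\star_{-1_i}=-J^\star_{1_i}$; these subdivide $J^\star_{1}$ and $J^\star_{-1}$. Alphabet $F=\{\varepsilon1_i:\varepsilon=+,-,\ 1\le i\le\kappa_q\}\cup(\mathbb{Z}\setminus\{0,\pm1\})$, where $\varepsilon 1_i$ are formal symbols. The transition matrix $\mathbb{A}$ over $F$ has entries: $\mathbb{A}_{\varepsilon1_i,\varepsilon1_{i+1}}=1$ for $\varepsilon=\pm$, $1\le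 i\le\kappa_q-1$; $\mathbb{A}_{\varepsilon1_{\kappa_q},m}=1$ for all $m\in F$ with $m\ne\varepsilon1_i$ for all $1\le i\le\kappa_q$; $\mathbb{A}_{m,n}=1$ for integers $m$ with $|m|\ge2$ and all $n\in F$ with $n\ne\mathrm{sign}(m)1_1$; all other entries are $0$. $F_{\mathbb{A}}^{\mathbb{N}}=\{(\xi_i)_{i\in\mathbb{N}}:\xi_i\in F,\ \mathbb{A}_{\xi_i,\xi_{i+1}}=1\ \forall i\}$ with shift $(\tau\underline\xi)_i=\xi_{i+1}$. For $\xi=\varepsilon1_i$ put $f_\xi^\star(x)=-\frac1x-\varepsilon\lambda_q$ on $J^\star_\xi$; for $\xi=m\in\mathbb{Z}$, $|m|\ge2$, put $f_\xi^\star(x)=-\frac1x-m\lambda_q$ on $J^\star_m$. The condition $x\in J^\star_{\xi_1}\cap\bigcap_{l\ge1}(f^\star_{\xi_l}\circ\cdots\circ f^\star_{\xi_1})^{-1}J^\star_{\xi_{l+1}}$ means that $x\in J^\star_{\xi_1}$ and successively $f^\star_{\xi_l}\circ\cdots\circ f^\star_{\xi_1}(x)\in J^\star_{\xi_{l+1}}$ for all $l\ge1$. $\underline{r}_q$ is the symbol sequence of the point $r_q=\psi_1$, namely the periodic sequence $\overline{(1_2,1_3,\dots,1_{\kappa_q},2)}$ (equal to $\overline{(2)}$ when $\kappa_q=1$), and $-\underline{r}_q$ is obtained from it by changing all signs. Finally $\partial\mathcal{M}(f_q^\star)=\{y\in I_{R_q}:\exists\,n\in\mathbb{Z}_{\ge0}\text{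 with }(f_q^\star)^n(y)=\pm r_q\text{ or }(f_q^\star)^n(y)=0\}$. *)

theory Defs
  imports Complex_Main
begin

text \<open>All definitions below are meant for even \<open>q \<ge> 4\<close>. In particular the values of
  \<open>kap\<close>, \<open>R_q\<close> and \<open>r_q\<close> are those of the even case.\<close>

definition lam :: "nat \<Rightarrow> real" where
  "lam q = 2 * cos (pi / real q)"

definition kap :: "nat \<Rightarrow> nat" where
  "kap q = (q - 2) div 2"

definition R_q :: "nat \<Rightarrow> real" where
  "R_q q = 1"

definition r_q :: "nat \<Rightarrow> real" where
  "r_q q = 1 - lam q"

definition I_q :: "nat \<Rightarrow> real set" where
  "I_q q = {- R_q q .. R_q q}"

text \<open>The description for \<open>x \<ge> 0\<close> is proper, since the half-open intervals
  \<open>[n * lam q + r_q q, n * lam q + R_q q)\<close> have length \<open>R_q q - r_q q = lam q > 0\<close> and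
  therefore tile the line.\<close>

definition nearest_nonneg :: "nat \<Rightarrow> real \<Rightarrow> int" where
  "nearest_nonneg q x =
     (THE n. of_int n * lam q + r_q q \<le> x \<and> x < of_int n * lam q + R_q q)"

definition nearest :: "nat \<Rightarrow> real \<Rightarrow> int" where
  "nearest q x = (if x \<ge> 0 then nearest_nonneg q x else - nearest_nonneg q (- x))"

definition fstar :: "nat \<Rightarrow> real \<Rightarrow> real" where
  "fstar q y = (if y = 0 then 0 else - 1 / y - of_int (nearest q (- 1 / y)) * lam q)"

definition psi :: "nat \<Rightarrow> nat \<Rightarrow> real" where
  "psi q i = (fstar q ^^ i) (- R_q q)"

text \<open>\<open>Unit \<epsilon> i\<close> is the formal symbol \<open>\<epsilon>1\<^sub>i\<close>, the sign being encoded as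
  \<open>\<epsilon> \<in> {1, -1}\<close>; \<open>Dig m\<close> is the integer \<open>m\<close>. The type has further elements, the
  alphabet is the set \<open>alphabet q\<close>.\<close>

datatype letter = Unit int nat | Dig int

definition alphabet :: "nat \<Rightarrow> letter set" where
  "alphabet q = {Unit \<epsilon> i | \<epsilon> i. \<epsilon> \<in> {1, -1} \<and> i \<in> {1..kap q}} \<union> {Dig m | m. m \<notin> {0, 1, -1}}"

definition J_pos :: "nat \<Rightarrow> int \<Rightarrow> real set" where
  "J_pos q m = {- 1 / (r_q q + of_int m * lam q) .. - 1 / (r_q q + of_int (m + 1) * lam q)}"

fun J_star :: "nat \<Rightarrow> letter \<Rightarrow> real set" where
  "J_star q (Unit \<epsilon> i) =
     (if \<epsilon> = 1 then {psi q (i - 1) .. psi q i} else uminus ` {psi q (i - 1) .. psi q i})"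
| "J_star q (Dig m) = (if m > 0 then J_pos q m else uminus ` J_pos q (- m))"

definition trans_mat :: "nat \<Rightarrow> letter \<Rightarrow> letter \<Rightarrow> nat" where
  "trans_mat q a b =
     (if (\<exists>\<epsilon>\<in>{1, -1}. \<exists>i\<in>{1..kap q - 1}. a = Unit \<epsilon> i \<and> b = Unit \<epsilon> (i + 1))
       \<or> (\<exists>\<epsilon>\<in>{1, -1}. a = Unit \<epsilon> (kap q) \<and> b \<in> alphabet q \<and> (\<forall>i\<in>{1..kap q}. b \<noteq> Unit \<epsilon> i))
       \<or> (\<exists>m. \<bar>m\<bar> \<ge> 2 \<and> a = Dig m \<and> b \<in> alphabet q \<and> b \<noteq> Unit (sgn m) 1)
      then 1 else 0)"

text \<open>Sequences are indexed from \<open>0\<close>: \<open>\<xi> i\<close> is the \<open>(i+1)\<close>-st symbol.\<close>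

definition FAN :: "nat \<Rightarrow> (nat \<Rightarrow> letter) set" where
  "FAN q = {\<xi>. (\<forall>i. \<xi> i \<in> alphabet q) \<and> (\<forall>i. trans_mat q (\<xi> i) (\<xi> (Suc i)) = 1)}"

definition shift :: "(nat \<Rightarrow> letter) \<Rightarrow> nat \<Rightarrow> letter" where
  "shift \<xi> = (\<lambda>i. \<xi> (Suc i))"

fun neg_letter :: "letter \<Rightarrow> letter" where
  "neg_letter (Unit \<epsilon> i) = Unit (- \<epsilon>) i"
| "neg_letter (Dig m) = Dig (- m)"

definition periodic_seq :: "letter list \<Rightarrow> nat \<Rightarrow> letter" where
  "periodic_seq xs = (\<lambda>i. xs ! (i mod length xs))"

text \<open>The periodic block \<open>1\<^sub>2, \<dots>, 1\<^sub>\<kappa>, 2\<close> with \<open>\<kappa> = kap q\<close>.\<close>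

definition r_seq :: "nat \<Rightarrow> nat \<Rightarrow> letter" where
  "r_seq q = periodic_seq (map (Unit 1) [2..<Suc (kap q)] @ [Dig 2])"

definition FAN_reg :: "nat \<Rightarrow> (nat \<Rightarrow> letter) set" where
  "FAN_reg q = FAN q -
     {\<xi> \<in> FAN q. \<exists>n. (shift ^^ n) \<xi> = r_seq q \<or> (shift ^^ n) \<xi> = neg_letter \<circ> r_seq q}"

definition bdM :: "nat \<Rightarrow> real set" where
  "bdM q = {y \<in> I_q q. \<exists>n. (fstar q ^^ n) y = r_q q \<or> (fstar q ^^ n) y = - r_q q
                          \<or> (fstar q ^^ n) y = 0}"

definition is_coding :: "nat \<Rightarrow> real \<Rightarrow> (nat \<Rightarrow> letter) \<Rightarrow> bool" where
  "is_coding q x \<xi> \<longleftrightarrow> (\<forall>i. \<xi> i \<in> alphabet q) \<and> (\<forall>i. (fstar q ^^ i) x \<in> J_star q (\<xi> i))"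

definition pi_map :: "nat \<Rightarrow> real \<Rightarrow> nat \<Rightarrow> letter" where
  "pi_map q x = (THE \<xi>. is_coding q x \<xi>)"

text \<open>The formulas for the branches are used on all of \<open>\<real>\<close>. The restriction of the branch for
  \<open>a\<close> to \<open>J_star q a\<close> is enforced in \<open>cyl\<close>, which intersects over all \<open>l\<close>, so that each branch is
  applied only to points of its domain.\<close>

fun branch :: "nat \<Rightarrow> letter \<Rightarrow> real \<Rightarrow> real" where
  "branch q (Unit \<epsilon> i) x = - 1 / x - of_int \<epsilon> * lam q"
| "branch q (Dig m) x = - 1 / x - of_int m * lam q"

fun branch_comp :: "nat \<Rightarrow> (nat \<Rightarrow> letter) \<Rightarrow> nat \<Rightarrow> real \<Rightarrow> real" where
  "branch_comp q \<xi> 0 = id"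
| "branch_comp q \<xi> (Suc l) = branch q (\<xi> l) \<circ> branch_comp q \<xi> l"

definition cyl :: "nat \<Rightarrow> (nat \<Rightarrow> letter) \<Rightarrow> real set" where
  "cyl q \<xi> = J_star q (\<xi> 0) \<inter> (\<Inter>l\<in>{1..}. branch_comp q \<xi> l -` J_star q (\<xi> l))"

definition pi_inv :: "nat \<Rightarrow> (nat \<Rightarrow> letter) \<Rightarrow> real" where
  "pi_inv q \<xi> = (THE x. x \<in> I_q q \<and> x \<in> cyl q \<xi>)"

end

theory Submission
  imports Defs "HOL-Analysis.Elementary_Normed_Spaces"
begin

text \<open>Up to sign, the intervals \<open>J\<close> are the gaps between consecutive terms of one increasing
  sequence \<open>brk\<close>, which runs through \<open>\<psi>\<^sub>0 < \<dots> < \<psi>\<^sub>\<kappa>\<close> and then through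
  \<open>-1 / (r\<^sub>q + m \<lambda>\<^sub>q)\<close>, \<open>m \<ge> 3\<close>, up to \<open>0\<close>. On each gap the branch is increasing with explicit
  end values, so the admissible transitions are exactly the Markov covering relations and every
  admissible sequence has a nonempty cylinder by compactness. Two points \<open>x, y\<close> of a common
  interval satisfy \<open>\<bar>x - y\<bar> = \<bar>x y\<bar> \<bar>f x - f y\<bar>\<close>. Although \<open>\<bar>x\<bar>\<close> may be \<open>1\<close>, the product
  \<open>\<bar>x f x\<bar>\<close> is bounded by a constant less than \<open>1\<close>, so two steps of the branches are uniformly
  expanding and cylinders are single points. Finally, an itinerary that hits an endpoint of one
  of its intervals must end in that of \<open>\<plusminus>r\<^sub>q\<close>. Hence regular itineraries stay in the interiors, where the
  branches agree with the map.\<close>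

locale even_hecke =
  fixes q :: nat
  assumes q_ge_4: "q \<ge> 4" and even_q: "even q"
begin

section \<open>Size of the parameters\<close>

abbreviation "\<kappa> \<equiv> kap q"
abbreviation "\<Lambda> \<equiv> lam q"

lemma q_eq: "q = 2 * \<kappa> + 2"
  using q_ge_4 even_q by (auto simp: kap_def elim!: evenE)

lemma kap_pos: "0 < \<kappa>"
  using q_ge_4 by (auto simp: kap_def)

lemma lam_gt_1: "1 < \<Lambda>" and lam_lt_2: "\<Lambda> < 2"
proof -
  have *: "pi / real q < pi / 3" "0 < pi / real q"
    using q_ge_4 divide_strict_left_mono[of 3 "real q" pi] by auto
  have "cos (pi / 3) < cos (pi / real q)"
    using * by (intro cos_monotone_0_pi) auto
  thus "1 < \<Lambda>" by (simp add: lam_def cos_60)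
  have "cos (pi / real q) < cos 0"
    using * pi_gt_zero q_ge_4 by (intro cos_monotone_0_pi) (auto simp: field_simps)
  thus "\<Lambda> < 2" by (simp add: lam_def)
qed

section \<open>The cosine sequence and the break points\<close>

definition cosn :: "nat \<Rightarrow> real" where
  "cosn n = cos ((real n - 1/2) * (pi / real q))"

lemma cosn_rec: "cosn (Suc (Suc n)) = \<Lambda> * cosn (Suc n) - cosn n"
proof -
  let ?t = "pi / real q" and ?a = "(real (Suc n) - 1/2) * (pi / real q)"
  have "(real (Suc (Suc n)) - 1/2) * ?t = ?a + ?t" "(real n - 1/2) * ?t = ?a - ?t"
    by (simp_all add: algebra_simps add_divide_distrib diff_divide_distrib)
  thus ?thesis unfolding cosn_def by (simp only: cos_add cos_diff lam_def) simp
qed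

text \<open>The half-step in the phase makes the first two angles opposite. This symmetry encodes
  the start value -1 of the ratio \<open>- cosn (Suc n) / cosn n\<close>.\<close>

lemma cosn_0: "cosn 0 = cosn 1"
  using cos_minus[of "pi / (real q * 2)"] by (simp add: cosn_def)

lemma cosn_pos: "n \<le> Suc \<kappa> \<Longrightarrow> 0 < cosn n"
proof -
  assume n: "n \<le> Suc \<kappa>"
  have qpos: "0 < real q" using q_ge_4 by simp
  have "(real n - 1/2) < real q / 2" using n by (subst q_eq) auto
  hence "(real n - 1/2) * (pi / real q) < real q / 2 * (pi / real q)"
    using qpos by (intro mult_strict_right_mono) auto
  moreover have "- (real q / 2) < real n - 1/2" using q_ge_4 by simp
  hence "- (real q / 2) * (pi / real q) < (real n - 1/2) * (pi / real q)"
    using qpos by (intro mult_strict_right_mono) auto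
  ultimately show ?thesis
    unfolding cosn_def using qpos by (intro cos_gt_zero_pi) auto
qed

text \<open>As \<open>q = 2 * \<kappa> + 2\<close>, the angles of the terms
  \<open>Suc \<kappa>\<close> and \<open>Suc (Suc \<kappa>)\<close> add up to \<pi>. These terms are
  therefore opposite, and the recurrence closes up.\<close>

lemma cosn_kap: "cosn \<kappa> = (1 + \<Lambda>) * cosn (Suc \<kappa>)"
proof -
  have qpos: "0 < real q" using q_ge_4 by simp
  have q: "real q = 2 * real \<kappa> + 2" by (subst q_eq) simp
  have "(real (Suc (Suc \<kappa>)) - 1/2) * (pi / real q) = pi - (real (Suc \<kappa>) - 1/2) * (pi / real q)"
    unfolding q by (simp add: divide_simps) (simp add: algebra_simps)
  hence "cosn (Suc (Suc \<kappa>)) = - cosn (Suc \<kappa>)"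
    unfolding cosn_def by (simp only: cos_pi_minus)
  with cosn_rec[of \<kappa>] show ?thesis by (simp add: algebra_simps)
qed

text \<open>The branch \<open>x \<mapsto> - 1 / x - \<lambda>\<^sub>q\<close> is elliptic. Writing \<open>x = - u\<^sub>1 / u\<^sub>0\<close> turns it into the recurrence
  \<open>u\<^sub>2 = \<lambda>\<^sub>q u\<^sub>1 - u\<^sub>0\<close>, whose solution with \<open>u\<^sub>0 = u\<^sub>1\<close> is proportional to \<open>cosn\<close>. This gives
  the closed form of \<open>\<psi>\<^sub>n\<close> in the first case. The second case is \<open>- 1 / (r\<^sub>q + m \<lambda>\<^sub>q)\<close> with
  \<open>m = n - \<kappa> + 2\<close>.\<close>

definition brk :: "nat \<Rightarrow> real" where
  "brk n = (if n \<le> \<kappa> then - cosn (Suc n) / cosn n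
            else - 1 / (1 + (real n - real \<kappa> + 1) * \<Lambda>))"

lemma brk_0: "brk 0 = - 1"
  using cosn_pos[of 0] by (simp add: brk_def cosn_0)

lemma brk_Suc:
  assumes "n < \<kappa>" shows "brk (Suc n) = - 1 / brk n - \<Lambda>"
  using assms cosn_pos[of n] cosn_pos[of "Suc n"]
  by (simp add: brk_def cosn_rec divide_simps)

lemma brk_1: "brk 1 = r_q q"
  using brk_Suc[of 0] kap_pos by (simp add: brk_0 r_q_def)

text \<open>By the closing relation \<open>cosn_kap\<close> the two formulas for \<open>brk\<close>
  agree at \<kappa>, so the second may start there.\<close>

lemma brk_ge:
  assumes "\<kappa> \<le> n" shows "brk n = - 1 / (1 + (real n - real \<kappa> + 1) * \<Lambda>)"
proof (cases "n = \<kappa>")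
  case True
  thus ?thesis using cosn_kap cosn_pos[of "Suc \<kappa>"] lam_gt_1
    by (simp add: brk_def divide_simps)
qed (use assms in \<open>simp add: brk_def\<close>)

lemma brk_neg: "brk n < 0"
proof (cases "n \<le> \<kappa>")
  case True
  thus ?thesis using cosn_pos[of n] cosn_pos[of "Suc n"] by (simp add: brk_def)
next
  case False
  hence "0 \<le> (real n - real \<kappa> + 1) * \<Lambda>" using lam_gt_1 by simp
  thus ?thesis using False by (simp add: brk_ge divide_simps)
qed

text \<open>Below \<kappa> the increment at x = \<open>brk n\<close> is -(x^2 + \<Lambda> x + 1) /
  x. The quadratic is positive because \<Lambda> < 2, and x is negative. From \<kappa> on the
  denominators increase.\<close>

lemma brk_strict_mono: "strict_mono brk"
proof (rule strict_mono_Suc_iff[THEN iffD2, rule_format])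
  fix n
  show "brk n < brk (Suc n)"
  proof (cases "n < \<kappa>")
    case True
    let ?x = "brk n"
    have "0 < (?x + \<Lambda> / 2)\<^sup>2 + (1 - \<Lambda>\<^sup>2 / 4)"
    proof -
      have "\<Lambda>\<^sup>2 < 2\<^sup>2" using lam_gt_1 lam_lt_2 by (intro power_strict_mono) auto
      hence "0 < 1 - \<Lambda>\<^sup>2 / 4" by simp
      thus ?thesis by (intro add_nonneg_pos) auto
    qed
    hence "- 1 - \<Lambda> * ?x - ?x * ?x < 0" by (simp add: power2_eq_square algebra_simps)
    hence "0 < (- 1 - \<Lambda> * ?x - ?x * ?x) / ?x" using brk_neg[of n] by (intro divide_neg_neg)
    also have "\<dots> = brk (Suc n) - ?x"
      using brk_neg[of n] by (simp add: brk_Suc[OF True] field_simps)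
    finally show ?thesis by simp
  next
    case False
    have "0 \<le> (real n - real \<kappa> + 1) * \<Lambda>" using lam_gt_1 False by simp
    moreover have "0 \<le> (real (Suc n) - real \<kappa> + 1) * \<Lambda>" using lam_gt_1 False by simp
    ultimately show ?thesis using False lam_gt_1 by (simp add: brk_ge field_simps)
  qed
qed

lemma brk_less_iff [simp]: "brk m < brk n \<longleftrightarrow> m < n"
  and brk_le_iff [simp]: "brk m \<le> brk n \<longleftrightarrow> m \<le> n"
  using brk_strict_mono strict_mono_less strict_mono_less_eq by blast+

lemma brk_ge_m1: "- 1 \<le> brk n"
  using brk_le_iff[of 0 n] brk_0 by simp

text \<open>The sequence climbs from -1 to 0, so its half-open gaps cover the negative half of the
  interval. The least index with \<open>x < brk n\<close> marks the right end of the gap.\<close>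

lemma brk_locate:
  assumes "- 1 \<le> x" "x < 0"
  obtains n where "brk n \<le> x" "x < brk (Suc n)"
proof -
  have "\<exists>n. x < brk n"
  proof -
    obtain k where k: "- 1 / x < real k" using reals_Archimedean2 by blast
    have "real k \<le> (real k + 1) * 1" by simp
    also have "\<dots> \<le> (real k + 1) * \<Lambda>" using lam_gt_1 by (intro mult_left_mono) auto
    finally have *: "- 1 / x < 1 + (real k + 1) * \<Lambda>" using k by simp
    have "0 < - 1 / x" using assms by (simp add: divide_simps)
    hence pos: "0 < 1 + (real k + 1) * \<Lambda>" using * by linarith
    from * assms pos have "x < - 1 / (1 + (real k + 1) * \<Lambda>)" by (simp add: field_simps)
    hence "x < brk (k + \<kappa>)" by (simp add: brk_ge)
    thus ?thesis by blast
  qed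
  then obtain n where n: "x < brk n" "\<forall>m<n. \<not> x < brk m"
    using exists_least_iff[of "\<lambda>n. x < brk n"] by auto
  have "n \<noteq> 0" using n(1) assms brk_0 by (metis not_le)
  then obtain m where "n = Suc m" using not0_implies_Suc by blast
  thus ?thesis using n that[of m] by auto
qed

section \<open>Letters, branches and transitions in terms of a sign and a gap\<close>

definition dig :: "nat \<Rightarrow> int" where
  "dig n = (if n < \<kappa> then 1 else int n - int \<kappa> + 2)"

text \<open>A letter is a sign and a gap index counted from 0. The symbols with digit 1 occupy the
  gaps below \<kappa>, and gap \<kappa> carries the digit 2. Letters of sign 1 sit on the negative
  half line.\<close>

definition sl :: "int \<Rightarrow> nat \<Rightarrow> letter" where
  "sl \<epsilon> n = (if n < \<kappa> then Unit \<epsilon> (Suc n) else Dig (\<epsilon> * dig n))"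

definition gmap :: "nat \<Rightarrow> real \<Rightarrow> real" where
  "gmap n x = - 1 / x - of_int (dig n) * \<Lambda>"

lemma dig_ge: "1 \<le> dig n"
  by (simp add: dig_def)

text \<open>For \<open>n \<ge> \<kappa>\<close> the digit exceeds the multiple of \<Lambda> in
  \<open>- 1 / brk n\<close> by one, which leaves 1 - \<Lambda>. So left ends move up one index at a
  time and then fall back to \<open>brk 1\<close>.\<close>

lemma gmap_left: "gmap n (brk n) = brk (if n < \<kappa> then Suc n else 1)"
  using brk_Suc[of n] by (auto simp: gmap_def dig_def brk_1[simplified] brk_ge r_q_def algebra_simps)

lemma gmap_right: "gmap n (brk (Suc n)) = (if Suc n < \<kappa> then brk (Suc (Suc n)) else 1)"
proof (cases "Suc n < \<kappa>")
  case False
  \<comment> \<open>The formula for the later digits extends down to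
    \<open>n = \<kappa> - 1\<close>, where it gives 1.\<close>
  hence *: "of_int (dig n) = real n - real \<kappa> + 2" by (auto simp: dig_def)
  show ?thesis using False unfolding gmap_def * by (simp add: brk_ge algebra_simps)
qed (simp add: gmap_def dig_def brk_Suc[of "Suc n"])

lemma gmap_mono: "x \<le> y \<Longrightarrow> y < 0 \<Longrightarrow> gmap n x \<le> gmap n y"
  by (auto simp: gmap_def field_simps)

lemma gmap_strict_mono: "x < y \<Longrightarrow> y < 0 \<Longrightarrow> gmap n x < gmap n y"
  by (auto simp: gmap_def field_simps)

lemma nearest_nonneg_eq:
  assumes "of_int n * \<Lambda> + r_q q \<le> x" "x < of_int n * \<Lambda> + 1"
  shows "nearest_nonneg q x = n"
  unfolding nearest_nonneg_def
proof (rule the_equality)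
  show "of_int n * \<Lambda> + r_q q \<le> x \<and> x < of_int n * \<Lambda> + R_q q"
    using assms by (simp add: R_q_def)
next
  fix m assume m: "of_int m * \<Lambda> + r_q q \<le> x \<and> x < of_int m * \<Lambda> + R_q q"
  have L: "0 < \<Lambda>" using lam_gt_1 by simp
  have "of_int m * \<Lambda> < of_int (n + 1) * \<Lambda>" "of_int n * \<Lambda> < of_int (m + 1) * \<Lambda>"
    using m assms by (auto simp: R_q_def r_q_def algebra_simps)
  hence "real_of_int m < of_int (n + 1)" "real_of_int n < of_int (m + 1)"
    using L by (auto simp: mult_less_cancel_right)
  thus "m = n" by linarith
qed

text \<open>The branch sends the half-open gap into [\<open>r_q q\<close>, 1), which is the
  condition that fixes the integer in \<open>nearest_nonneg\<close>. At the right end the value may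
  be 1, where that condition fails.\<close>

lemma fstar_eq:
  assumes "brk n \<le> x" "x < brk (Suc n)"
  shows "fstar q x = gmap n x"
proof -
  have x: "x < 0" using assms brk_neg[of "Suc n"] by simp
  have "gmap n (brk n) \<le> gmap n x" "gmap n x < gmap n (brk (Suc n))"
    using assms x brk_neg by (auto intro: gmap_mono gmap_strict_mono)
  moreover have "r_q q \<le> gmap n (brk n)"
    by (auto simp: gmap_left brk_1[symmetric])
  moreover have "gmap n (brk (Suc n)) \<le> 1"
    using brk_neg[of "Suc (Suc n)"] by (auto simp: gmap_right)
  ultimately have "nearest_nonneg q (- 1 / x) = dig n"
    by (intro nearest_nonneg_eq) (auto simp: gmap_def)
  moreover have "0 \<le> - 1 / x" using x by (simp add: divide_simps)
  ultimately show ?thesis using x by (simp add: fstar_def nearest_def gmap_def)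
qed

lemma fstar_minus: "fstar q (- x) = - fstar q x"
proof -
  have "nearest q (- y) = - nearest q y" if "y \<noteq> 0" for y
    using that by (auto simp: nearest_def)
  from this[of "1 / x"] show ?thesis by (auto simp: fstar_def)
qed

lemma psi_eq: "n \<le> \<kappa> \<Longrightarrow> psi q n = brk n"
proof (induction n)
  case 0
  thus ?case by (simp add: psi_def brk_0 R_q_def)
next
  case (Suc n)
  hence "psi q (Suc n) = fstar q (brk n)" by (simp add: psi_def)
  also have "\<dots> = gmap n (brk n)" by (rule fstar_eq) auto
  finally show ?case using Suc.prems by (simp add: gmap_left)
qed

lemma J_pos_dig: "\<kappa> \<le> n \<Longrightarrow> J_pos q (dig n) = {brk n .. brk (Suc n)}"
  by (simp add: J_pos_def dig_def brk_ge r_q_def algebra_simps)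

text \<open>The dictionary that reduces later questions about the intervals to the gaps of
  \<open>brk\<close>.\<close>

lemma mem_J_sl:
  assumes "\<epsilon> \<in> {1, -1}"
  shows "x \<in> J_star q (sl \<epsilon> n) \<longleftrightarrow> of_int \<epsilon> * x \<in> {brk n .. brk (Suc n)}"
proof -
  have "J_star q (sl \<epsilon> n) = (if \<epsilon> = 1 then {brk n .. brk (Suc n)} else uminus ` {brk n .. brk (Suc n)})"
  proof (cases "n < \<kappa>")
    case True
    thus ?thesis by (simp add: sl_def psi_eq del: image_uminus_atLeastAtMost)
  next
    case False
    hence "J_pos q (dig n) = {brk n .. brk (Suc n)}" "0 < dig n"
      using J_pos_dig[of n] dig_ge[of n] by auto
    thus ?thesis using False assms by (auto simp: sl_def simp del: image_uminus_atLeastAtMost)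
  qed
  thus ?thesis using assms by auto
qed

lemma branch_sl: "\<epsilon> \<in> {1, -1} \<Longrightarrow> branch q (sl \<epsilon> n) x = of_int \<epsilon> * gmap n (of_int \<epsilon> * x)"
  by (auto simp: sl_def gmap_def dig_def algebra_simps)

lemma alphabet_sl: "\<epsilon> \<in> {1, -1} \<Longrightarrow> sl \<epsilon> n \<in> alphabet q"
  by (auto simp: sl_def alphabet_def dig_def)

lemma alphabetE:
  assumes "a \<in> alphabet q"
  obtains \<epsilon> n where "\<epsilon> \<in> {1, -1}" "a = sl \<epsilon> n"
proof (cases a)
  case (Unit \<epsilon> i)
  hence "\<epsilon> \<in> {1, -1}" "a = sl \<epsilon> (i - 1)" using assms by (auto simp: alphabet_def sl_def)
  thus ?thesis using that by blast
next
  case (Dig m)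
  hence m: "\<bar>m\<bar> \<ge> 2" using assms by (auto simp: alphabet_def)
  hence "sgn m \<in> {1, -1}" "a = sl (sgn m) (nat (\<bar>m\<bar> - 2) + \<kappa>)"
    using Dig by (auto simp: sl_def dig_def sgn_if)
  thus ?thesis using that by blast
qed

text \<open>The right-hand side says that the closed image of gap n covers the signed gap m. By
  \<open>gmap_left\<close> and \<open>gmap_right\<close> the image is gap \<open>Suc n\<close> if
  \<open>Suc n < \<kappa>\<close>, it is [\<open>brk \<kappa>\<close>, 1] if
  \<open>Suc n = \<kappa>\<close>, and [\<open>brk 1\<close>, 1] otherwise.\<close>

lemma trans_sl:
  assumes "\<epsilon> \<in> {1, -1}" "\<delta> \<in> {1, -1}"
  shows "trans_mat q (sl \<epsilon> n) (sl \<delta> m) = 1 \<longleftrightarrow>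
    (if Suc n < \<kappa> then \<delta> = \<epsilon> \<and> m = Suc n else \<delta> = \<epsilon> \<longrightarrow> (if Suc n = \<kappa> then \<kappa> \<le> m else 0 < m))"
proof -
  have b: "sl \<delta> m \<in> alphabet q" using alphabet_sl assms by simp
  have 1: "(\<exists>\<epsilon>'\<in>{1, -1}. \<exists>i\<in>{1..\<kappa> - 1}. sl \<epsilon> n = Unit \<epsilon>' i \<and> sl \<delta> m = Unit \<epsilon>' (i + 1))
      \<longleftrightarrow> Suc n < \<kappa> \<and> \<delta> = \<epsilon> \<and> m = Suc n"
    using assms by (auto simp: sl_def)
  have 2: "(\<exists>\<epsilon>'\<in>{1, -1}. sl \<epsilon> n = Unit \<epsilon>' \<kappa> \<and> sl \<delta> m \<in> alphabet q \<and> (\<forall>i\<in>{1..\<kappa>}. sl \<delta> m \<noteq> Unit \<epsilon>' i))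
      \<longleftrightarrow> Suc n = \<kappa> \<and> (\<delta> = \<epsilon> \<longrightarrow> \<kappa> \<le> m)"
    using assms b by (auto simp: sl_def)
  have 3: "(\<exists>k. \<bar>k\<bar> \<ge> 2 \<and> sl \<epsilon> n = Dig k \<and> sl \<delta> m \<in> alphabet q \<and> sl \<delta> m \<noteq> Unit (sgn k) 1)
      \<longleftrightarrow> \<kappa> \<le> n \<and> (\<delta> = \<epsilon> \<longrightarrow> 0 < m)"
    using assms b kap_pos by (auto simp: sl_def dig_def sgn_if)
  show ?thesis unfolding trans_mat_def 1 2 3 by auto
qed

lemma gmap_mem:
  assumes "x \<in> {brk n .. brk (Suc n)}"
  shows "gmap n x \<in> {brk (if n < \<kappa> then Suc n else 1) .. (if Suc n < \<kappa> then brk (Suc (Suc n)) else 1)}"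
proof -
  have "gmap n (brk n) \<le> gmap n x" "gmap n x \<le> gmap n (brk (Suc n))"
    using assms brk_neg[of "Suc n"] by (auto intro!: gmap_mono)
  thus ?thesis unfolding gmap_left gmap_right by simp
qed

lemma abs_gmap_le_1:
  assumes "x \<in> {brk n .. brk (Suc n)}"
  shows "\<bar>gmap n x\<bar> \<le> 1"
  using gmap_mem[OF assms] brk_ge_m1[of 1] brk_ge_m1[of "Suc n"] brk_neg[of "Suc (Suc n)"]
  by (auto split: if_splits)

section \<open>Contraction and uniqueness of orbits with prescribed letters\<close>

definition ctr :: real where
  "ctr = max (\<Lambda> - 1) (1 / (1 + \<Lambda>))"

lemma ctr_nonneg: "0 \<le> ctr" and ctr_less_1: "ctr < 1"
  using lam_gt_1 lam_lt_2 by (auto simp: ctr_def le_max_iff_disj)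

lemma brk_kap: "brk \<kappa> = - 1 / (1 + \<Lambda>)"
  by (simp add: brk_ge)

text \<open>For digit 1 the product is -1 - \<Lambda> x, with extreme values \<Lambda> - 1 at x = -1
  and -1 / (1 + \<Lambda>) at x = \<open>brk \<kappa>\<close>. For larger digits x itself is at most
  1 / (1 + \<Lambda>) in absolute value and its image at most 1.\<close>

lemma abs_mult_gmap_le:
  assumes "x \<in> {brk n .. brk (Suc n)}"
  shows "\<bar>x * gmap n x\<bar> \<le> ctr"
proof (cases "n < \<kappa>")
  case True
  have x: "- 1 \<le> x" "x \<le> - 1 / (1 + \<Lambda>)" "x < 0"
    using assms brk_ge_m1[of n] brk_le_iff[of "Suc n" \<kappa>] brk_neg[of "Suc n"] True
    by (auto simp: brk_kap)
  have eq: "x * gmap n x = - 1 - \<Lambda> * x"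
    using True x by (simp add: gmap_def dig_def algebra_simps)
  have "\<Lambda> * (- 1) \<le> \<Lambda> * x" "\<Lambda> * x \<le> \<Lambda> * (- 1 / (1 + \<Lambda>))"
    using x lam_gt_1 by (intro mult_left_mono; simp)+
  moreover have "\<Lambda> * (- 1 / (1 + \<Lambda>)) = - 1 + 1 / (1 + \<Lambda>)"
    using lam_gt_1 by (simp add: field_simps)
  ultimately have "- (1 / (1 + \<Lambda>)) \<le> x * gmap n x" "x * gmap n x \<le> \<Lambda> - 1"
    unfolding eq by auto
  moreover have "1 / (1 + \<Lambda>) \<le> ctr" "\<Lambda> - 1 \<le> ctr" by (auto simp: ctr_def)
  ultimately show ?thesis by linarith
next
  case False
  have "brk \<kappa> \<le> x" "x < 0"
    using assms brk_le_iff[of \<kappa> n] False brk_neg[of "Suc n"] by (auto simp del: brk_le_iff)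
  hence "\<bar>x\<bar> \<le> 1 / (1 + \<Lambda>)" by (simp add: brk_kap)
  hence "\<bar>x\<bar> * \<bar>gmap n x\<bar> \<le> 1 / (1 + \<Lambda>) * 1"
    using abs_gmap_le_1[OF assms] lam_gt_1 by (intro mult_mono) auto
  thus ?thesis by (simp add: abs_mult ctr_def)
qed

lemma J_star_bounds:
  assumes "a \<in> alphabet q" "x \<in> J_star q a"
  shows "\<bar>x\<bar> \<le> 1" "x \<noteq> 0"
proof -
  obtain \<epsilon> n where a: "\<epsilon> \<in> {1, -1}" "a = sl \<epsilon> n" using assms(1) by (rule alphabetE)
  have x: "of_int \<epsilon> * x \<in> {brk n .. brk (Suc n)}" using assms(2) mem_J_sl a by simp
  hence "\<bar>of_int \<epsilon> * x\<bar> \<le> 1" "of_int \<epsilon> * x \<noteq> 0"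
    using brk_neg[of "Suc n"] brk_ge_m1[of n] by (auto simp: abs_le_iff)
  thus "\<bar>x\<bar> \<le> 1" "x \<noteq> 0" using a(1) by auto
qed

lemma branch_bounds:
  assumes "a \<in> alphabet q" "x \<in> J_star q a"
  shows "\<bar>x * branch q a x\<bar> \<le> ctr"
proof -
  obtain \<epsilon> n where a: "\<epsilon> \<in> {1, -1}" "a = sl \<epsilon> n" using assms(1) by (rule alphabetE)
  have x: "of_int \<epsilon> * x \<in> {brk n .. brk (Suc n)}" using assms(2) mem_J_sl a by simp
  from abs_mult_gmap_le[OF x] show ?thesis using a by (auto simp: branch_sl)
qed

text \<open>Only branches occur here, so the notion covers both points of cylinders and orbits of
  \<open>fstar\<close>, and one uniqueness result serves both.\<close>

definition path :: "(nat \<Rightarrow> letter) \<Rightarrow> (nat \<Rightarrow> real) \<Rightarrow> bool" where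
  "path \<xi> X \<longleftrightarrow> (\<forall>l. \<xi> l \<in> alphabet q \<and> X l \<in> J_star q (\<xi> l) \<and> X (Suc l) = branch q (\<xi> l) (X l))"

lemma pathD:
  assumes "path \<xi> X"
  shows "\<xi> l \<in> alphabet q" "X l \<in> J_star q (\<xi> l)" "X (Suc l) = branch q (\<xi> l) (X l)"
  using assms by (auto simp: path_def)

lemma branch_diff:
  assumes "x \<noteq> 0" "y \<noteq> 0"
  shows "x - y = (x * y) * (branch q a x - branch q a y)"
  using assms by (cases a) (auto simp: field_simps)

text \<open>Two steps shrink the distance backwards by the factor \<open>ctr\<^sup>2\<close>, while
  all distances stay at most 2. Going 2N steps ahead and letting N grow forces the initial points to
  agree.\<close>

lemma path_unique:
  assumes X: "path \<xi> X" and Y: "path \<xi> Y"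
  shows "X 0 = Y 0"
proof -
  note bX = J_star_bounds[OF pathD(1,2)[OF X]] and bY = J_star_bounds[OF pathD(1,2)[OF Y]]
  have step: "X l - Y l = (X l * Y l) * (X (Suc l) - Y (Suc l))" for l
    using branch_diff[OF bX(2) bY(2), of l l "\<xi> l"]
    by (simp only: pathD(3)[OF X, symmetric] pathD(3)[OF Y, symmetric])
  have two: "\<bar>X l - Y l\<bar> \<le> ctr\<^sup>2 * \<bar>X (Suc (Suc l)) - Y (Suc (Suc l))\<bar>" for l
  proof -
    have cX: "\<bar>X l * X (Suc l)\<bar> \<le> ctr" and cY: "\<bar>Y l * Y (Suc l)\<bar> \<le> ctr"
      using branch_bounds[OF pathD(1,2)[OF X], of l] branch_bounds[OF pathD(1,2)[OF Y], of l]
      by (simp_all only: pathD(3)[OF X, symmetric] pathD(3)[OF Y, symmetric])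
    \<comment> \<open>The four factors are regrouped along each orbit, since
      \<open>X l * Y l\<close> alone may have absolute value 1.\<close>
    have "X l - Y l = ((X l * X (Suc l)) * (Y l * Y (Suc l))) * (X (Suc (Suc l)) - Y (Suc (Suc l)))"
      by (subst step[of l], subst step[of "Suc l"]) (simp only: mult_ac)
    hence "\<bar>X l - Y l\<bar> = (\<bar>X l * X (Suc l)\<bar> * \<bar>Y l * Y (Suc l)\<bar>) * \<bar>X (Suc (Suc l)) - Y (Suc (Suc l))\<bar>"
      by (simp only: abs_mult)
    also have "\<dots> \<le> (ctr * ctr) * \<bar>X (Suc (Suc l)) - Y (Suc (Suc l))\<bar>"
      using cX cY ctr_nonneg by (intro mult_right_mono mult_mono) auto
    finally show ?thesis by (simp add: power2_eq_square)
  qed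
  have bound: "\<bar>X 0 - Y 0\<bar> \<le> (ctr\<^sup>2) ^ N * \<bar>X (2 * N) - Y (2 * N)\<bar>" for N
  proof (induction N)
    case (Suc N)
    note Suc
    also have "(ctr\<^sup>2) ^ N * \<bar>X (2 * N) - Y (2 * N)\<bar>
        \<le> (ctr\<^sup>2) ^ N * (ctr\<^sup>2 * \<bar>X (Suc (Suc (2 * N))) - Y (Suc (Suc (2 * N)))\<bar>)"
      using two[of "2 * N"] by (intro mult_left_mono) auto
    finally show ?case by (simp add: mult_ac)
  qed simp
  have "\<bar>X 0 - Y 0\<bar> \<le> (ctr\<^sup>2) ^ N * 2" for N
  proof -
    have "\<bar>X (2 * N) - Y (2 * N)\<bar> \<le> 2" using bX(1)[of "2 * N"] bY(1)[of "2 * N"] by linarith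
    hence "(ctr\<^sup>2) ^ N * \<bar>X (2 * N) - Y (2 * N)\<bar> \<le> (ctr\<^sup>2) ^ N * 2" by (intro mult_left_mono) auto
    with bound[of N] show ?thesis by linarith
  qed
  moreover have "(\<lambda>N. (ctr\<^sup>2) ^ N * 2) \<longlonglongrightarrow> 0"
  proof -
    have "ctr\<^sup>2 < 1" using ctr_nonneg ctr_less_1 by (simp add: power_less_one_iff)
    thus ?thesis by (intro tendsto_mult_left_zero LIMSEQ_power_zero) auto
  qed
  ultimately have "\<bar>X 0 - Y 0\<bar> \<le> 0" by (intro LIMSEQ_le_const[of "\<lambda>N. (ctr\<^sup>2) ^ N * 2"]) auto
  thus ?thesis by simp
qed

section \<open>Existence and uniqueness of the point of a cylinder\<close>

lemma FAN_D:
  assumes "\<xi> \<in> FAN q"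
  shows "\<xi> i \<in> alphabet q" "trans_mat q (\<xi> i) (\<xi> (Suc i)) = 1"
  using assms by (auto simp: FAN_def)

lemma FAN_shift: "\<xi> \<in> FAN q \<Longrightarrow> shift \<xi> \<in> FAN q"
  by (auto simp: FAN_def shift_def)

lemma cyl_iff: "x \<in> cyl q \<xi> \<longleftrightarrow> (\<forall>l. branch_comp q \<xi> l x \<in> J_star q (\<xi> l))"
proof
  assume x: "x \<in> cyl q \<xi>"
  show "\<forall>l. branch_comp q \<xi> l x \<in> J_star q (\<xi> l)"
  proof
    fix l show "branch_comp q \<xi> l x \<in> J_star q (\<xi> l)"
      using x by (cases "l = 0") (auto simp: cyl_def)
  qed
next
  assume *: "\<forall>l. branch_comp q \<xi> l x \<in> J_star q (\<xi> l)"
  show "x \<in> cyl q \<xi>" using * *[rule_format, of 0] by (auto simp: cyl_def)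
qed

lemma cyl_path:
  assumes "\<xi> \<in> FAN q" "x \<in> cyl q \<xi>"
  shows "path \<xi> (\<lambda>l. branch_comp q \<xi> l x)"
  using assms by (auto simp: path_def cyl_iff FAN_D)

text \<open>Since \<open>branch q a 1 = - 1 - m * lam q\<close> for the digit \<open>m\<close> of \<open>a\<close>, the denominator is
  \<open>y + m * lam q\<close>.\<close>

definition inv_branch :: "letter \<Rightarrow> real \<Rightarrow> real" where
  "inv_branch a y = - 1 / (y - branch q a 1 - 1)"

text \<open>An admissible transition means that the interval of b lies in the image of the interval
  of a, so the inverse branch leads back into the interval of a.\<close>

lemma markov:
  assumes "a \<in> alphabet q" "b \<in> alphabet q" "trans_mat q a b = 1" "y \<in> J_star q b"
  shows "inv_branch a y \<in> J_star q a" "branch q a (inv_branch a y) = y"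
proof -
  obtain \<epsilon> n where a: "\<epsilon> \<in> {1, -1}" "a = sl \<epsilon> n" using assms(1) by (rule alphabetE)
  obtain \<delta> m where b: "\<delta> \<in> {1, -1}" "b = sl \<delta> m" using assms(2) by (rule alphabetE)
  have y: "of_int \<delta> * y \<in> {brk m .. brk (Suc m)}" using assms(4) b by (simp add: mem_J_sl)
  have tr: "if Suc n < \<kappa> then \<delta> = \<epsilon> \<and> m = Suc n
      else \<delta> = \<epsilon> \<longrightarrow> (if Suc n = \<kappa> then \<kappa> \<le> m else 0 < m)"
    using assms(3) trans_sl[OF a(1) b(1)] a b by simp
  let ?z = "of_int \<epsilon> * y"
  have z1: "\<bar>?z\<bar> \<le> 1"
    using J_star_bounds(1)[OF assms(2,4)] a by auto
  have zl: "gmap n (brk n) \<le> ?z"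
  proof (cases "\<delta> = \<epsilon>")
    case True
    have "brk (if n < \<kappa> then Suc n else 1) \<le> brk m" using tr True by (auto split: if_splits)
    thus ?thesis using y True unfolding gmap_left by (auto simp del: brk_le_iff intro: order_trans)
  next
    case False
    hence "\<delta> = - \<epsilon>" using a b by auto
    hence "0 \<le> ?z" using y brk_neg[of "Suc m"] by auto
    thus ?thesis using brk_neg[of "if n < \<kappa> then Suc n else 1"] by (simp add: gmap_left)
  qed
  have zr: "?z \<le> gmap n (brk (Suc n))"
    using tr y z1 unfolding gmap_right by (auto split: if_splits)
  let ?h = "- 1 / (?z + of_int (dig n) * \<Lambda>)"
  have "1 * \<Lambda> \<le> real_of_int (dig n) * \<Lambda>" using dig_ge[of n] lam_gt_1 by (intro mult_right_mono) auto
  hence pos: "0 < ?z + of_int (dig n) * \<Lambda>" using z1 lam_gt_1 by linarith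
  have h: "?h < 0" "gmap n ?h = ?z" using pos by (auto simp: gmap_def)
  \<comment> \<open>A violation of either bound on \<open>?h\<close> would be carried by the
    increasing branch to a violation of \<open>zl\<close> or \<open>zr\<close>.\<close>
  have "brk n \<le> ?h"
  proof (rule ccontr)
    assume "\<not> brk n \<le> ?h"
    hence "?h < brk n" by simp
    from gmap_strict_mono[OF this brk_neg, of n] h(2) zl show False by simp
  qed
  moreover have "?h \<le> brk (Suc n)"
  proof (rule ccontr)
    assume "\<not> ?h \<le> brk (Suc n)"
    hence "brk (Suc n) < ?h" by simp
    from gmap_strict_mono[OF this h(1), of n] h(2) zr show False by simp
  qed
  moreover have ih: "inv_branch a y = of_int \<epsilon> * ?h"
    using a pos by (auto simp: inv_branch_def branch_sl gmap_def field_simps)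
  moreover have e: "of_int \<epsilon> * (of_int \<epsilon> * t) = t" for t :: real using a by auto
  ultimately show "inv_branch a y \<in> J_star q a"
    using a by (simp only: mem_J_sl[OF a(1)] e) auto
  show "branch q a (inv_branch a y) = y"
    by (simp only: ih, simp only: a(2) branch_sl[OF a(1)] e h(2))
qed

lemma inv_branch_branch: "x \<noteq> 0 \<Longrightarrow> inv_branch a (branch q a x) = x"
  by (cases a) (auto simp: inv_branch_def)

text \<open>The pole lies outside [-1, 1] because the digit has absolute value at least 1 and
  \<Lambda> > 1.\<close>

lemma continuous_on_inv_branch:
  assumes "a \<in> alphabet q"
  shows "continuous_on {- 1 .. 1} (inv_branch a)"
proof -
  obtain \<epsilon> n where a: "\<epsilon> \<in> {1, -1}" "a = sl \<epsilon> n" using assms(1) by (rule alphabetE)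
  have "1 * \<Lambda> \<le> real_of_int (dig n) * \<Lambda>" using dig_ge[of n] lam_gt_1 by (intro mult_right_mono) auto
  hence "1 < real_of_int (dig n) * \<Lambda>" using lam_gt_1 by linarith
  hence "y - branch q a 1 - 1 \<noteq> 0" if "y \<in> {-1..1}" for y
    using a that by (auto simp: branch_sl gmap_def)
  thus ?thesis unfolding inv_branch_def by (intro continuous_intros) auto
qed

definition fin_cyl :: "(nat \<Rightarrow> letter) \<Rightarrow> nat \<Rightarrow> real set" where
  "fin_cyl \<xi> N = {x. \<forall>l\<le>N. branch_comp q \<xi> l x \<in> J_star q (\<xi> l)}"

text \<open>\<open>branch_comp\<close> recurses at the last letter, whereas the induction over
  cylinders peels off the first.\<close>

lemma branch_comp_Suc_shift:
  "branch_comp q \<xi> (Suc l) x = branch_comp q (shift \<xi>) l (branch q (\<xi> 0) x)"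
  by (induction l) (auto simp: shift_def)

lemma fin_cyl_Suc:
  assumes "\<xi> \<in> FAN q"
  shows "fin_cyl \<xi> (Suc N) = inv_branch (\<xi> 0) ` fin_cyl (shift \<xi>) N"
proof (intro equalityI subsetI)
  fix x assume x: "x \<in> fin_cyl \<xi> (Suc N)"
  have "branch q (\<xi> 0) x \<in> fin_cyl (shift \<xi>) N"
    unfolding fin_cyl_def mem_Collect_eq
  proof (intro allI impI)
    fix l assume "l \<le> N"
    hence "branch_comp q \<xi> (Suc l) x \<in> J_star q (\<xi> (Suc l))"
      using x unfolding fin_cyl_def by blast
    thus "branch_comp q (shift \<xi>) l (branch q (\<xi> 0) x) \<in> J_star q (shift \<xi> l)"
      by (simp only: branch_comp_Suc_shift) (simp add: shift_def)
  qed
  moreover have "x \<in> J_star q (\<xi> 0)" using x by (auto simp: fin_cyl_def dest: spec[of _ 0])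
  hence "inv_branch (\<xi> 0) (branch q (\<xi> 0) x) = x"
    using J_star_bounds(2) FAN_D(1)[OF assms] by (intro inv_branch_branch) auto
  ultimately show "x \<in> inv_branch (\<xi> 0) ` fin_cyl (shift \<xi>) N" by (metis image_eqI)
next
  fix x assume "x \<in> inv_branch (\<xi> 0) ` fin_cyl (shift \<xi>) N"
  then obtain y where y: "y \<in> fin_cyl (shift \<xi>) N" "x = inv_branch (\<xi> 0) y" by blast
  have "y \<in> J_star q (\<xi> (Suc 0))" using y(1) by (auto simp: fin_cyl_def shift_def dest: spec[of _ 0])
  note m = markov[OF FAN_D(1)[OF assms] FAN_D(1)[OF assms] FAN_D(2)[OF assms] this, folded y(2)]
  show "x \<in> fin_cyl \<xi> (Suc N)"
    unfolding fin_cyl_def mem_Collect_eq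
  proof (intro allI impI)
    fix l assume "l \<le> Suc N"
    show "branch_comp q \<xi> l x \<in> J_star q (\<xi> l)"
    proof (cases l)
      case 0
      thus ?thesis using m(1) by simp
    next
      case (Suc k)
      hence "branch_comp q (shift \<xi>) k y \<in> J_star q (shift \<xi> k)"
        using y(1) \<open>l \<le> Suc N\<close> by (auto simp: fin_cyl_def)
      thus ?thesis unfolding Suc branch_comp_Suc_shift m(2) by (simp add: shift_def)
    qed
  qed
qed

text \<open>A cylinder of depth 0 is a closed interval, and each further letter in front takes a
  continuous image under an inverse branch.\<close>

lemma fin_cyl_compact_nonempty:
  assumes "\<xi> \<in> FAN q"
  shows "compact (fin_cyl \<xi> N) \<and> fin_cyl \<xi> N \<noteq> {}"
  using assms
proof (induction N arbitrary: \<xi>)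
  case 0
  obtain \<epsilon> n where a: "\<epsilon> \<in> {1, -1}" "\<xi> 0 = sl \<epsilon> n"
    using alphabetE[OF FAN_D(1)[OF 0, of 0]] by blast
  have "fin_cyl \<xi> 0 = (if \<epsilon> = 1 then {brk n .. brk (Suc n)} else {- brk (Suc n) .. - brk n})"
    using a by (auto simp: fin_cyl_def mem_J_sl)
  thus ?case by auto
next
  case (Suc N)
  note IH = Suc.IH[OF FAN_shift[OF Suc.prems]]
  have "fin_cyl (shift \<xi>) N \<subseteq> {- 1 .. 1}"
  proof
    fix y assume "y \<in> fin_cyl (shift \<xi>) N"
    hence "y \<in> J_star q (\<xi> (Suc 0))" by (auto simp: fin_cyl_def shift_def dest: spec[of _ 0])
    thus "y \<in> {- 1 .. 1}" using J_star_bounds(1)[OF FAN_D(1)[OF Suc.prems]] by (auto simp: abs_le_iff)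
  qed
  hence "continuous_on (fin_cyl (shift \<xi>) N) (inv_branch (\<xi> 0))"
    using continuous_on_inv_branch[OF FAN_D(1)[OF Suc.prems]] continuous_on_subset by blast
  thus ?case using IH by (auto simp: fin_cyl_Suc[OF Suc.prems] intro: compact_continuous_image)
qed

lemma cyl_nonempty:
  assumes "\<xi> \<in> FAN q"
  shows "cyl q \<xi> \<noteq> {}"
proof -
  have mono: "fin_cyl \<xi> N \<subseteq> fin_cyl \<xi> M" if "M \<le> N" for M N
    unfolding fin_cyl_def by (intro Collect_mono allI impI) (use that in \<open>simp del: branch_comp.simps\<close>)
  have "\<Inter> (range (fin_cyl \<xi>)) \<noteq> {}"
    using fin_cyl_compact_nonempty[OF assms] mono by (intro compact_nest[of "fin_cyl \<xi>"]) simp_all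
  moreover have "(\<Inter>N. fin_cyl \<xi> N) \<subseteq> cyl q \<xi>"
  proof
    fix x assume "x \<in> (\<Inter>N. fin_cyl \<xi> N)"
    hence "x \<in> fin_cyl \<xi> l" for l by (rule INT_D) simp
    hence "branch_comp q \<xi> l x \<in> J_star q (\<xi> l)" for l unfolding fin_cyl_def by blast
    thus "x \<in> cyl q \<xi>" unfolding cyl_iff ..
  qed
  ultimately show ?thesis by blast
qed

lemma cyl_unique:
  assumes "\<xi> \<in> FAN q" "x \<in> cyl q \<xi>" "y \<in> cyl q \<xi>"
  shows "x = y"
proof -
  have "branch_comp q \<xi> 0 x = branch_comp q \<xi> 0 y"
    using cyl_path[OF assms(1,2)] cyl_path[OF assms(1,3)] by (rule path_unique)
  thus ?thesis by simp
qed

lemma cyl_subset_I: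
  assumes "\<xi> \<in> FAN q"
  shows "cyl q \<xi> \<subseteq> I_q q"
proof
  fix x assume "x \<in> cyl q \<xi>"
  hence "x \<in> J_star q (\<xi> 0)" by (simp add: cyl_def)
  hence "\<bar>x\<bar> \<le> 1" by (rule J_star_bounds(1)[OF FAN_D(1)[OF assms]])
  thus "x \<in> I_q q" by (auto simp: I_q_def R_q_def abs_le_iff)
qed

section \<open>Regular sequences avoid the endpoints\<close>

lemma shift_funpow: "(shift ^^ n) \<xi> = (\<lambda>i. \<xi> (n + i))"
  by (induction n) (auto simp: shift_def)

text \<open>The block \<open>1\<^sub>2, \<dots>, 1\<^sub>\<kappa>, 2\<close> runs through the gaps 1
  to \<kappa>, the digit 2 being gap \<kappa>. For \<kappa> = 1 only this last entry
  remains.\<close>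

lemma r_seq_sl: "r_seq q k = sl 1 (1 + k mod \<kappa>)"
proof -
  have len: "length (map (Unit 1) [2..<Suc \<kappa>] @ [Dig 2]) = \<kappa>" using kap_pos by auto
  have "k mod \<kappa> < \<kappa>" using kap_pos by simp
  thus ?thesis unfolding r_seq_def periodic_seq_def len
    by (auto simp: nth_append sl_def dig_def simp del: upt_Suc)
qed

lemma neg_letter_sl: "neg_letter (sl \<epsilon> n) = sl (- \<epsilon>) n"
  by (simp add: sl_def)

lemma regular_not_r_tail:
  assumes "\<xi> \<in> FAN_reg q" "\<epsilon> \<in> {1, -1}"
  shows "\<exists>k. \<xi> (l + k) \<noteq> sl \<epsilon> (1 + k mod \<kappa>)"
proof (rule ccontr)
  assume "\<not> ?thesis"
  hence *: "(shift ^^ l) \<xi> = (\<lambda>k. sl \<epsilon> (1 + k mod \<kappa>))" by (auto simp: shift_funpow)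
  have "(shift ^^ l) \<xi> = r_seq q \<or> (shift ^^ l) \<xi> = neg_letter \<circ> r_seq q"
    unfolding * using assms(2) by (auto simp: fun_eq_iff r_seq_sl neg_letter_sl)
  thus False using assms(1) by (auto simp: FAN_reg_def)
qed

lemma path_Suc:
  assumes "path \<xi> X" "\<epsilon> \<in> {1, -1}" "\<xi> l = sl \<epsilon> n" "X l = of_int \<epsilon> * x"
  shows "X (Suc l) = of_int \<epsilon> * gmap n x"
  using assms(2) by (auto simp: pathD(3)[OF assms(1)] assms(3,4) branch_sl)

lemma J_brk:
  assumes "a \<in> alphabet q" "\<epsilon> \<in> {1, -1}" "of_int \<epsilon> * brk j \<in> J_star q a"
  shows "a = sl \<epsilon> j \<or> 0 < j \<and> a = sl \<epsilon> (j - 1)"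
proof -
  obtain \<delta> n where a: "\<delta> \<in> {1, -1}" "a = sl \<delta> n" using assms(1) by (rule alphabetE)
  have m: "of_int \<delta> * (of_int \<epsilon> * brk j) \<in> {brk n .. brk (Suc n)}"
    using assms(3) mem_J_sl[OF a(1)] a(2) by simp
  have "\<delta> = \<epsilon>"
  proof (rule ccontr)
    assume "\<delta> \<noteq> \<epsilon>"
    hence "of_int \<delta> * (of_int \<epsilon> * brk j) = - brk j" using a assms(2) by auto
    thus False using m brk_neg[of j] brk_neg[of "Suc n"] by simp
  qed
  hence "brk n \<le> brk j" "brk j \<le> brk (Suc n)" using m assms(2) by auto
  hence "n = j \<or> 0 < j \<and> n = j - 1" by auto
  thus ?thesis using a \<open>\<delta> = \<epsilon>\<close> by auto
qed

lemma FAN_trans: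
  assumes "\<xi> \<in> FAN q" "\<epsilon> \<in> {1, -1}" "\<delta> \<in> {1, -1}" "\<xi> l = sl \<epsilon> n" "\<xi> (Suc l) = sl \<delta> m"
  shows "if Suc n < \<kappa> then \<delta> = \<epsilon> \<and> m = Suc n else \<delta> = \<epsilon> \<longrightarrow> (if Suc n = \<kappa> then \<kappa> \<le> m else 0 < m)"
  using FAN_D(2)[OF assms(1), of l] trans_sl[OF assms(2,3), of n m] assms(4,5) by simp

text \<open>The image \<open>brk n'\<close> is shared by the gaps \<open>n'\<close> and
  \<open>n' - 1\<close>, and the transition matrix forbids the second. Hence a left end is followed
  by a left end.\<close>

lemma path_left_Suc:
  assumes "\<xi> \<in> FAN q" "path \<xi> X" "\<epsilon> \<in> {1, -1}" "\<xi> l = sl \<epsilon> n" "X l = of_int \<epsilon> * brk n"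
  defines "n' \<equiv> if n < \<kappa> then Suc n else 1"
  shows "X (Suc l) = of_int \<epsilon> * brk n' \<and> \<xi> (Suc l) = sl \<epsilon> n'"
proof -
  have X: "X (Suc l) = of_int \<epsilon> * brk n'"
    unfolding n'_def gmap_left[symmetric] by (rule path_Suc[OF assms(2-5)])
  have "of_int \<epsilon> * brk n' \<in> J_star q (\<xi> (Suc l))"
    using pathD(2)[OF assms(2), of "Suc l"] X by simp
  from J_brk[OF pathD(1)[OF assms(2)] assms(3) this]
  have "\<xi> (Suc l) = sl \<epsilon> n' \<or> 0 < n' \<and> \<xi> (Suc l) = sl \<epsilon> (n' - 1)" .
  moreover have "\<xi> (Suc l) \<noteq> sl \<epsilon> (n' - 1)"
    using FAN_trans[OF assms(1,3,3,4), of "n' - 1"] by (auto simp: n'_def split: if_splits)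
  ultimately show ?thesis using X by blast
qed

lemma mod_Suc_cycle:
  "1 + Suc k mod \<kappa> = (if 1 + k mod \<kappa> < \<kappa> then Suc (1 + k mod \<kappa>) else 1)"
  using kap_pos mod_less_divisor[OF kap_pos, of k] by (auto simp: mod_Suc)

text \<open>From a left end the path runs through left ends forever, and its index eventually cycles
  through 1 to \<kappa>. The letters then form a tail equal to the sequence of \<open>r_q q\<close>
  or its negative.\<close>

lemma regular_not_left:
  assumes "\<xi> \<in> FAN_reg q" "path \<xi> X" "\<epsilon> \<in> {1, -1}" "\<xi> l = sl \<epsilon> n"
  shows "X l \<noteq> of_int \<epsilon> * brk n"
proof
  assume X: "X l = of_int \<epsilon> * brk n"
  have F: "\<xi> \<in> FAN q" using assms(1) by (simp add: FAN_reg_def)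
  note step = path_left_Suc[OF F assms(2,3)]
  have r: False if "\<xi> m = sl \<epsilon> 1" "X m = of_int \<epsilon> * brk 1" for m
  proof -
    have "X (m + k) = of_int \<epsilon> * brk (1 + k mod \<kappa>) \<and> \<xi> (m + k) = sl \<epsilon> (1 + k mod \<kappa>)" for k
    proof (induction k)
      case 0
      thus ?case using that by simp
    next
      case (Suc k)
      thus ?case using step[of "m + k" "1 + k mod \<kappa>"] unfolding mod_Suc_cycle by simp
    qed
    thus False using regular_not_r_tail[OF assms(1,3), of m] by blast
  qed
  \<comment> \<open>The index climbs to \<kappa> in \<open>\<kappa> - n\<close> steps. Once it is at
    least \<kappa>, the next point is the left end of gap 1, where \<open>r\<close> applies.\<close>
  show False
    using assms(4) X
  proof (induction "\<kappa> - n" arbitrary: l n)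
    case 0
    thus False using step[of l n] r[of "Suc l"] by simp
  next
    case (Suc d)
    hence "X (Suc l) = of_int \<epsilon> * brk (Suc n)" "\<xi> (Suc l) = sl \<epsilon> (Suc n)"
      using step[of l n] by auto
    moreover have "d = \<kappa> - Suc n" using Suc.hyps(2) by arith
    ultimately show False using Suc.hyps(1) by blast
  qed
qed

text \<open>Right ends move to right ends until the image is 1. With the sign this is the left end
  of gap 0 of the opposite sign, which reduces the claim to left ends.\<close>

lemma regular_not_right:
  assumes "\<xi> \<in> FAN_reg q" "path \<xi> X" "\<epsilon> \<in> {1, -1}" "\<xi> l = sl \<epsilon> n"
  shows "X l \<noteq> of_int \<epsilon> * brk (Suc n)"
proof
  assume "X l = of_int \<epsilon> * brk (Suc n)"
  have F: "\<xi> \<in> FAN q" using assms(1) by (simp add: FAN_reg_def)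
  show False
    using assms(4) \<open>X l = _\<close>
  proof (induction "\<kappa> - n" arbitrary: l n rule: less_induct)
    case less
    have X: "X (Suc l) = of_int \<epsilon> * (if Suc n < \<kappa> then brk (Suc (Suc n)) else 1)"
      using path_Suc[OF assms(2,3) less.prems] by (simp only: gmap_right)
    obtain \<delta> m where d: "\<delta> \<in> {1, -1}" "\<xi> (Suc l) = sl \<delta> m"
      using alphabetE[OF pathD(1)[OF assms(2), of "Suc l"]] by blast
    show False
    proof (cases "Suc n < \<kappa>")
      case True
      hence "\<xi> (Suc l) = sl \<epsilon> (Suc n)"
        using FAN_trans[OF F assms(3) d(1) less.prems(1) d(2)] d by simp
      moreover have "\<kappa> - Suc n < \<kappa> - n" using True by arith
      ultimately show False using less.hyps[of "Suc n" "Suc l"] True X by simp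
    next
      case False
      hence X': "X (Suc l) = of_int (- \<epsilon>) * brk 0" using X by (simp add: brk_0)
      have e: "- \<epsilon> \<in> {1, -1}" using assms(3) by auto
      \<comment> \<open>The first break point has no gap before it, so the letter is
        determined.\<close>
      have "\<xi> (Suc l) = sl (- \<epsilon>) 0"
        using J_brk[OF pathD(1)[OF assms(2)] e, of 0 "Suc l"] pathD(2)[OF assms(2), of "Suc l"] X' by simp
      thus False using regular_not_left[OF assms(1,2) e] X' by blast
    qed
  qed
qed

lemma regular_interior:
  assumes "\<xi> \<in> FAN_reg q" "path \<xi> X" "\<epsilon> \<in> {1, -1}" "\<xi> l = sl \<epsilon> n"
  shows "of_int \<epsilon> * X l \<in> {brk n <..< brk (Suc n)}"
proof -
  have mem: "of_int \<epsilon> * X l \<in> {brk n .. brk (Suc n)}"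
    using pathD(2)[OF assms(2), of l] assms(4) mem_J_sl[OF assms(3)] by simp
  have "of_int \<epsilon> * X l \<noteq> brk m" if "m \<in> {n, Suc n}" for m
  proof
    assume "of_int \<epsilon> * X l = brk m"
    hence "X l = of_int \<epsilon> * brk m" using assms(3) by auto
    thus False using regular_not_left[OF assms] regular_not_right[OF assms] that by auto
  qed
  from this[of n] this[of "Suc n"] mem show ?thesis by (auto simp: order_less_le)
qed

lemma fstar_interior:
  assumes "\<epsilon> \<in> {1, -1}" "of_int \<epsilon> * x \<in> {brk n <..< brk (Suc n)}"
  shows "fstar q x = branch q (sl \<epsilon> n) x"
proof -
  have "fstar q (of_int \<epsilon> * x) = gmap n (of_int \<epsilon> * x)" using assms(2) by (intro fstar_eq) auto
  thus ?thesis using assms(1) fstar_minus[of x] by (auto simp: branch_sl)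
qed

lemma regular_path_orbit:
  assumes "\<xi> \<in> FAN_reg q" "path \<xi> X"
  shows "X l = (fstar q ^^ l) (X 0)"
proof (induction l)
  case (Suc l)
  obtain \<epsilon> n where e: "\<epsilon> \<in> {1, -1}" "\<xi> l = sl \<epsilon> n"
    using alphabetE[OF pathD(1)[OF assms(2), of l]] by blast
  have "X (Suc l) = fstar q (X l)"
    using fstar_interior[OF e(1) regular_interior[OF assms e]] pathD(3)[OF assms(2), of l] e(2) by simp
  thus ?case using Suc by simp
qed simp

lemma regular_path_ne_brk:
  assumes "\<xi> \<in> FAN_reg q" "path \<xi> X" "\<epsilon> \<in> {1, -1}"
  shows "X l \<noteq> of_int \<epsilon> * brk j"
proof
  assume X: "X l = of_int \<epsilon> * brk j"
  hence "\<xi> l = sl \<epsilon> j \<or> 0 < j \<and> \<xi> l = sl \<epsilon> (j - 1)"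
    using J_brk[OF pathD(1)[OF assms(2)] assms(3)] pathD(2)[OF assms(2), of l] by simp
  thus False
    using regular_not_left[OF assms, of l j] regular_not_right[OF assms, of l "j - 1"] X by auto
qed

text \<open>Staying in the interiors turns the path into the \<open>fstar\<close> orbit. It misses
  0, which lies in no interval, and the points \<plusminus>\<open>r_q q\<close>, which are signed
  copies of \<open>brk 1\<close>.\<close>

lemma regular_path_start:
  assumes "\<xi> \<in> FAN_reg q" "path \<xi> X"
  shows "X 0 \<in> I_q q - bdM q" "is_coding q (X 0) \<xi>"
proof -
  have "\<bar>X 0\<bar> \<le> 1" by (rule J_star_bounds(1)[OF pathD(1,2)[OF assms(2)]])
  moreover have "(fstar q ^^ l) (X 0) \<noteq> 0" "(fstar q ^^ l) (X 0) \<noteq> r_q q" "(fstar q ^^ l) (X 0) \<noteq> - r_q q" for l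
    using J_star_bounds(2)[OF pathD(1,2)[OF assms(2)], of l]
      regular_path_ne_brk[OF assms, of 1 l 1] regular_path_ne_brk[OF assms, of "-1" l 1]
    unfolding regular_path_orbit[OF assms, of l] brk_1 by auto
  ultimately show "X 0 \<in> I_q q - bdM q" by (auto simp: I_q_def R_q_def bdM_def)
  show "is_coding q (X 0) \<xi>"
    unfolding is_coding_def using pathD(1,2)[OF assms(2)] regular_path_orbit[OF assms] by metis
qed

section \<open>Codings of points outside the boundary set\<close>

lemma brk_orbit: "\<exists>k. (fstar q ^^ k) (brk n) = r_q q"
proof (induction "\<kappa> - n" arbitrary: n)
  case 0
  hence "(fstar q ^^ 1) (brk n) = r_q q" using fstar_eq[of n "brk n"] gmap_left[of n] brk_1 by simp
  thus ?case by blast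
next
  case (Suc d)
  have "d = \<kappa> - Suc n" and n: "n < \<kappa>" using Suc.hyps(2) by arith+
  then obtain k where k: "(fstar q ^^ k) (brk (Suc n)) = r_q q" using Suc.hyps(1) by blast
  have "fstar q (brk n) = brk (Suc n)" using fstar_eq[of n "brk n"] gmap_left[of n] n by simp
  hence "(fstar q ^^ Suc k) (brk n) = r_q q" using k by (simp only: funpow_Suc_right o_apply)
  thus ?case by blast
qed

lemma fstar_funpow_sign:
  "\<epsilon> \<in> {1, -1} \<Longrightarrow> (fstar q ^^ k) (of_int \<epsilon> * x) = of_int \<epsilon> * (fstar q ^^ k) x"
  by (induction k) (auto simp: fstar_minus)

text \<open>Every signed break point eventually falls onto \<plusminus>\<open>r_q q\<close>, so all
  endpoints of the intervals belong to \<open>bdM q\<close>.\<close>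

lemma not_bdM_ne_brk:
  assumes "x \<in> I_q q - bdM q" "\<epsilon> \<in> {1, -1}"
  shows "of_int \<epsilon> * x \<noteq> brk n"
proof
  assume "of_int \<epsilon> * x = brk n"
  hence x: "x = of_int \<epsilon> * brk n" using assms(2) by auto
  obtain k where "(fstar q ^^ k) (brk n) = r_q q" using brk_orbit by blast
  hence "(fstar q ^^ k) x = of_int \<epsilon> * r_q q" using fstar_funpow_sign[OF assms(2)] x by simp
  hence "x \<in> bdM q" using assms by (auto simp: bdM_def)
  thus False using assms by simp
qed

lemma fstar_in_I:
  assumes "x \<in> I_q q"
  shows "fstar q x \<in> I_q q"
proof -
  have neg: "\<bar>fstar q x\<bar> \<le> 1" if "- 1 \<le> x" "x < 0" for x
  proof -
    obtain n where "brk n \<le> x" "x < brk (Suc n)" using \<open>- 1 \<le> x\<close> \<open>x < 0\<close> by (rule brk_locate)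
    thus ?thesis using abs_gmap_le_1[of x n] fstar_eq[of n x] by simp
  qed
  have "\<bar>fstar q x\<bar> \<le> 1"
    using assms neg[of x] neg[of "- x"] fstar_minus[of x]
    by (cases x "0::real" rule: linorder_cases) (auto simp: I_q_def R_q_def fstar_def[of _ 0])
  thus ?thesis by (auto simp: I_q_def R_q_def abs_le_iff)
qed

lemma fstar_invariant:
  assumes "x \<in> I_q q - bdM q"
  shows "fstar q x \<in> I_q q - bdM q"
proof -
  have "fstar q x \<notin> bdM q"
  proof
    assume "fstar q x \<in> bdM q"
    then obtain n where "(fstar q ^^ n) (fstar q x) \<in> {r_q q, - r_q q, 0}"
      by (auto simp: bdM_def)
    hence "(fstar q ^^ Suc n) x \<in> {r_q q, - r_q q, 0}" by (simp only: funpow_Suc_right o_apply)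
    hence "x \<in> bdM q" using assms unfolding bdM_def by blast
    thus False using assms by simp
  qed
  thus ?thesis using assms fstar_in_I by simp
qed

lemma fstar_funpow_invariant: "x \<in> I_q q - bdM q \<Longrightarrow> (fstar q ^^ n) x \<in> I_q q - bdM q"
  by (induction n) (use fstar_invariant in auto)

lemma not_bdM_interior:
  assumes "x \<in> I_q q - bdM q" "\<epsilon> \<in> {1, -1}" "x \<in> J_star q (sl \<epsilon> n)"
  shows "of_int \<epsilon> * x \<in> {brk n <..< brk (Suc n)}"
  using assms(3) mem_J_sl[OF assms(2)] not_bdM_ne_brk[OF assms(1,2), of n]
    not_bdM_ne_brk[OF assms(1,2), of "Suc n"] by (auto simp: order_less_le)

lemma not_bdM_letter_unique:
  assumes "x \<in> I_q q - bdM q" "a \<in> alphabet q" "b \<in> alphabet q" "x \<in> J_star q a" "x \<in> J_star q b"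
  shows "a = b"
proof -
  obtain \<epsilon> n where a: "\<epsilon> \<in> {1, -1}" "a = sl \<epsilon> n" using assms(2) by (rule alphabetE)
  obtain \<delta> m where b: "\<delta> \<in> {1, -1}" "b = sl \<delta> m" using assms(3) by (rule alphabetE)
  have x: "of_int \<epsilon> * x \<in> {brk n <..< brk (Suc n)}" "of_int \<delta> * x \<in> {brk m <..< brk (Suc m)}"
    using not_bdM_interior assms a b by auto
  hence "of_int \<epsilon> * x < 0" "of_int \<delta> * x < 0" using brk_neg[of "Suc n"] brk_neg[of "Suc m"] by auto
  hence "\<epsilon> = \<delta>" using a b by auto
  hence "brk n < brk (Suc m)" "brk m < brk (Suc n)" using x by (auto simp del: brk_less_iff)
  hence "n = m" by simp
  thus ?thesis using a b \<open>\<epsilon> = \<delta>\<close> by simp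
qed

lemma not_bdM_letter_exists:
  assumes "x \<in> I_q q - bdM q"
  shows "\<exists>a\<in>alphabet q. x \<in> J_star q a"
proof -
  have "x \<noteq> 0"
  proof
    assume "x = 0"
    hence "(fstar q ^^ 0) x = 0" by simp
    thus False using assms unfolding bdM_def by blast
  qed
  define \<epsilon> :: int where "\<epsilon> = (if x < 0 then 1 else -1)"
  have e: "\<epsilon> \<in> {1, -1}" by (simp add: \<epsilon>_def)
  have "- 1 \<le> of_int \<epsilon> * x" "of_int \<epsilon> * x < 0"
    using assms \<open>x \<noteq> 0\<close> by (auto simp: \<epsilon>_def I_q_def R_q_def)
  then obtain n where "brk n \<le> of_int \<epsilon> * x" "of_int \<epsilon> * x < brk (Suc n)" by (rule brk_locate)
  hence "x \<in> J_star q (sl \<epsilon> n)" using mem_J_sl[OF e] by auto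
  thus ?thesis using alphabet_sl[OF e] by blast
qed

lemma coding_ex1:
  assumes "x \<in> I_q q - bdM q"
  shows "\<exists>!\<xi>. is_coding q x \<xi>"
proof -
  have "\<forall>i. \<exists>a. a \<in> alphabet q \<and> (fstar q ^^ i) x \<in> J_star q a"
    using not_bdM_letter_exists[OF fstar_funpow_invariant[OF assms]] by blast
  hence "\<exists>\<xi>. is_coding q x \<xi>" unfolding is_coding_def by metis
  moreover have "\<xi> = \<eta>" if "is_coding q x \<xi>" "is_coding q x \<eta>" for \<xi> \<eta>
    using that not_bdM_letter_unique[OF fstar_funpow_invariant[OF assms]]
    unfolding is_coding_def by (intro ext) blast
  ultimately show ?thesis by blast
qed

lemma coding_path:
  assumes "x \<in> I_q q - bdM q" "is_coding q x \<xi>"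
  shows "path \<xi> (\<lambda>l. (fstar q ^^ l) x)"
  unfolding path_def
proof (intro allI conjI)
  fix l
  show a: "\<xi> l \<in> alphabet q" and J: "(fstar q ^^ l) x \<in> J_star q (\<xi> l)"
    using assms(2) by (auto simp: is_coding_def)
  obtain \<epsilon> n where e: "\<epsilon> \<in> {1, -1}" "\<xi> l = sl \<epsilon> n" using a by (rule alphabetE)
  have "of_int \<epsilon> * (fstar q ^^ l) x \<in> {brk n <..< brk (Suc n)}"
    using not_bdM_interior[OF fstar_funpow_invariant[OF assms(1)] e(1)] J e(2) by simp
  thus "(fstar q ^^ Suc l) x = branch q (\<xi> l) ((fstar q ^^ l) x)"
    using fstar_interior[OF e(1)] e(2) by simp
qed

text \<open>The next point lies in the image of gap n and strictly inside its own gap m. Comparing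
  the ends of the two yields the transition condition.\<close>

lemma coding_FAN:
  assumes "x \<in> I_q q - bdM q" "is_coding q x \<xi>"
  shows "\<xi> \<in> FAN q"
proof -
  note P = coding_path[OF assms]
  have "trans_mat q (\<xi> l) (\<xi> (Suc l)) = 1" for l
  proof -
    let ?x = "(fstar q ^^ l) x" and ?y = "(fstar q ^^ Suc l) x"
    obtain \<epsilon> n where a: "\<epsilon> \<in> {1, -1}" "\<xi> l = sl \<epsilon> n" using pathD(1)[OF P, of l] by (rule alphabetE)
    obtain \<delta> m where b: "\<delta> \<in> {1, -1}" "\<xi> (Suc l) = sl \<delta> m"
      using pathD(1)[OF P, of "Suc l"] by (rule alphabetE)
    have x: "of_int \<epsilon> * ?x \<in> {brk n .. brk (Suc n)}"
      using pathD(2)[OF P, of l] mem_J_sl[OF a(1)] a(2) by simp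
    have y: "of_int \<delta> * ?y \<in> {brk m <..< brk (Suc m)}"
      using not_bdM_interior[OF fstar_funpow_invariant[OF assms(1), of "Suc l"] b(1)]
        pathD(2)[OF P, of "Suc l"] b(2) by simp
    have "?y = of_int \<epsilon> * gmap n (of_int \<epsilon> * ?x)"
      using pathD(3)[OF P, of l] branch_sl[OF a(1)] a(2) by simp
    hence ey: "of_int \<epsilon> * ?y = gmap n (of_int \<epsilon> * ?x)" using a(1) by auto
    have g: "of_int \<epsilon> * ?y \<in> {brk (if n < \<kappa> then Suc n else 1) .. (if Suc n < \<kappa> then brk (Suc (Suc n)) else 1)}"
      unfolding ey by (rule gmap_mem[OF x])
    have "(if Suc n < \<kappa> then \<delta> = \<epsilon> \<and> m = Suc n
        else \<delta> = \<epsilon> \<longrightarrow> (if Suc n = \<kappa> then \<kappa> \<le> m else 0 < m))"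
    proof (cases "\<delta> = \<epsilon>")
      case True
      \<comment> \<open>Interiority makes the comparison of break points strict, which gives the
        sharp inequality between indices.\<close>
      have "brk (if n < \<kappa> then Suc n else 1) < brk (Suc m)" using g y True by (simp del: brk_less_iff)
      hence 1: "(if n < \<kappa> then Suc n else 1) \<le> m" by (simp only: brk_less_iff)
      have "m \<le> Suc n" if "Suc n < \<kappa>"
      proof -
        have "brk m < brk (Suc (Suc n))" using g y True that by (simp del: brk_less_iff)
        thus ?thesis by simp
      qed
      thus ?thesis using 1 True by (auto split: if_splits)
    next
      case False
      hence "of_int \<delta> * ?y = - (of_int \<epsilon> * ?y)" using a b by auto
      \<comment> \<open>A change of sign requires an image reaching beyond 0, which excludes
        \<open>Suc n < \<kappa>\<close>.\<close>
      hence "0 < of_int \<epsilon> * ?y" using y brk_neg[of "Suc m"] by simp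
      hence "\<not> Suc n < \<kappa>" using g brk_neg[of "Suc (Suc n)"] by auto
      thus ?thesis using False by simp
    qed
    thus ?thesis using trans_sl[OF a(1) b(1)] a(2) b(2) by simp
  qed
  thus ?thesis using pathD(1)[OF P] by (auto simp: FAN_def)
qed

text \<open>The left ends of the gaps 1 to \<kappa> form a periodic orbit of the branches. This
  realises the symbol sequence of \<plusminus>\<open>r_q q\<close> as a path.\<close>

lemma r_path:
  assumes "\<epsilon> \<in> {1, -1}"
  shows "path (\<lambda>k. sl \<epsilon> (1 + k mod \<kappa>)) (\<lambda>k. of_int \<epsilon> * brk (1 + k mod \<kappa>))"
  unfolding path_def
proof (intro allI conjI)
  fix k
  let ?n = "1 + k mod \<kappa>"
  have e: "of_int \<epsilon> * (of_int \<epsilon> * t) = t" for t :: real using assms by auto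
  have n: "?n \<le> \<kappa>" using mod_less_divisor[OF kap_pos, of k] by simp
  show "sl \<epsilon> ?n \<in> alphabet q" by (rule alphabet_sl[OF assms])
  show "of_int \<epsilon> * brk ?n \<in> J_star q (sl \<epsilon> ?n)" by (simp only: mem_J_sl[OF assms] e) simp
  show "of_int \<epsilon> * brk (1 + Suc k mod \<kappa>) = branch q (sl \<epsilon> ?n) (of_int \<epsilon> * brk ?n)"
    by (simp only: branch_sl[OF assms] e gmap_left mod_Suc_cycle)
qed

lemma path_drop: "path \<xi> X \<Longrightarrow> path (\<lambda>k. \<xi> (n + k)) (\<lambda>k. X (n + k))"
  by (auto simp: path_def)

text \<open>If a tail of the coding were the sequence of \<plusminus>\<open>r_q q\<close>,
  uniqueness of paths would make the orbit hit that point, against the choice of x.\<close>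

lemma coding_regular:
  assumes "x \<in> I_q q - bdM q" "is_coding q x \<xi>"
  shows "\<xi> \<in> FAN_reg q"
proof -
  have "\<not> ((shift ^^ n) \<xi> = r_seq q \<or> (shift ^^ n) \<xi> = neg_letter \<circ> r_seq q)" for n
  proof
    assume "(shift ^^ n) \<xi> = r_seq q \<or> (shift ^^ n) \<xi> = neg_letter \<circ> r_seq q"
    hence "(\<lambda>k. \<xi> (n + k)) = (\<lambda>k. sl 1 (1 + k mod \<kappa>)) \<or> (\<lambda>k. \<xi> (n + k)) = (\<lambda>k. sl (- 1) (1 + k mod \<kappa>))"
      by (auto simp: shift_funpow fun_eq_iff r_seq_sl neg_letter_sl)
    then obtain \<epsilon> where e: "\<epsilon> \<in> {1, -1}" "(\<lambda>k. \<xi> (n + k)) = (\<lambda>k. sl \<epsilon> (1 + k mod \<kappa>))" by blast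
    have "(fstar q ^^ (n + 0)) x = of_int \<epsilon> * brk (1 + 0 mod \<kappa>)"
      using path_drop[OF coding_path[OF assms], of n] r_path[OF e(1)] unfolding e(2) by (rule path_unique)
    hence "of_int \<epsilon> * (fstar q ^^ n) x = brk 1" using e(1) by auto
    thus False using not_bdM_ne_brk[OF fstar_funpow_invariant[OF assms(1)] e(1)] by blast
  qed
  thus ?thesis using coding_FAN[OF assms] by (auto simp: FAN_reg_def)
qed

section \<open>The coding map and its inverse\<close>

lemma pi_map_coding: "x \<in> I_q q - bdM q \<Longrightarrow> is_coding q x (pi_map q x)"
  unfolding pi_map_def by (rule theI'[OF coding_ex1])

lemma pi_map_eq: "x \<in> I_q q - bdM q \<Longrightarrow> is_coding q x \<xi> \<Longrightarrow> pi_map q x = \<xi>"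
  using coding_ex1[of x] pi_map_coding[of x] by blast

text \<open>Injectivity is uniqueness of paths with given letters. A preimage of a regular sequence
  is any point of its cylinder.\<close>

lemma bij_betw_pi_map: "bij_betw (pi_map q) (I_q q - bdM q) (FAN_reg q)"
  unfolding bij_betw_def
proof (intro conjI equalityI subsetI inj_onI)
  fix x y assume x: "x \<in> I_q q - bdM q" and y: "y \<in> I_q q - bdM q" and eq: "pi_map q x = pi_map q y"
  have "(fstar q ^^ 0) x = (fstar q ^^ 0) y"
    using coding_path[OF x pi_map_coding[OF x]] coding_path[OF y pi_map_coding[OF y]]
    unfolding eq by (rule path_unique)
  thus "x = y" by simp
next
  fix \<xi> assume "\<xi> \<in> pi_map q ` (I_q q - bdM q)"
  thus "\<xi> \<in> FAN_reg q" using coding_regular[OF _ pi_map_coding] by blast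
next
  fix \<xi> assume xi: "\<xi> \<in> FAN_reg q"
  hence F: "\<xi> \<in> FAN q" by (simp add: FAN_reg_def)
  obtain x where "x \<in> cyl q \<xi>" using cyl_nonempty[OF F] by blast
  from regular_path_start[OF xi cyl_path[OF F this]]
  have "x \<in> I_q q - bdM q" "is_coding q x \<xi>" by simp_all
  thus "\<xi> \<in> pi_map q ` (I_q q - bdM q)" using pi_map_eq by blast
qed

lemma pi_map_fstar:
  assumes "x \<in> I_q q - bdM q"
  shows "pi_map q (fstar q x) = shift (pi_map q x)"
proof (rule pi_map_eq[OF fstar_invariant[OF assms]])
  have "(fstar q ^^ i) (fstar q x) = (fstar q ^^ Suc i) x" for i
    by (simp only: funpow_Suc_right o_apply)
  thus "is_coding q (fstar q x) (shift (pi_map q x))"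
    using pi_map_coding[OF assms] unfolding is_coding_def shift_def by metis
qed

lemma cyl_ex1:
  assumes "\<xi> \<in> FAN q"
  shows "\<exists>!x. x \<in> I_q q \<and> x \<in> cyl q \<xi>"
  using cyl_nonempty[OF assms] cyl_subset_I[OF assms] cyl_unique[OF assms] by blast

text \<open>The cylinder point of a regular sequence is coded by that sequence, so it is the
  preimage under the injective coding map.\<close>

lemma pi_inv_eq:
  assumes "\<xi> \<in> FAN_reg q"
  shows "pi_inv q \<xi> = the_inv_into (I_q q - bdM q) (pi_map q) \<xi>"
proof -
  have F: "\<xi> \<in> FAN q" using assms by (simp add: FAN_reg_def)
  have "pi_inv q \<xi> \<in> cyl q \<xi>" using theI'[OF cyl_ex1[OF F]] by (simp add: pi_inv_def)
  from regular_path_start[OF assms cyl_path[OF F this]]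
  have x: "pi_inv q \<xi> \<in> I_q q - bdM q" "is_coding q (pi_inv q \<xi>) \<xi>" by simp_all
  hence "pi_map q (pi_inv q \<xi>) = \<xi>" by (rule pi_map_eq)
  with x(1) show ?thesis
    using bij_betw_pi_map by (intro the_inv_into_f_eq[symmetric]) (auto simp: bij_betw_def)
qed

end

theorem lemma4p3p2:
  fixes q :: nat
  assumes "q \<ge> 4" and "even q"
  shows "(\<forall>x \<in> I_q q - bdM q. \<exists>!\<xi>. is_coding q x \<xi>)
       \<and> bij_betw (pi_map q) (I_q q - bdM q) (FAN_reg q)
       \<and> (\<forall>x \<in> I_q q - bdM q. fstar q x \<in> I_q q - bdM q
            \<and> pi_map q (fstar q x) = shift (pi_map q x))
       \<and> (\<forall>\<xi> \<in> FAN q. \<exists>!x. x \<in> I_q q \<and> x \<in> cyl q \<xi>)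
       \<and> (\<forall>\<xi> \<in> FAN_reg q. pi_inv q \<xi> = the_inv_into (I_q q - bdM q) (pi_map q) \<xi>)"
proof -
  interpret even_hecke q using assms by unfold_locales
  show ?thesis
    using coding_ex1 bij_betw_pi_map fstar_invariant pi_map_fstar cyl_ex1 pi_inv_eq by blast
qed

end
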